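(* Let $\sigma:A\to A^+$ be a substitution on a finite alphabet $A$ (with $X_\sigma$ uncountable). Then for every $x\in X_\sigma$ there exist $y\in X_\sigma$ and $i\in\{0,\dots,|\sigma(y[0])|-1\}$ such that $x=T_\sigma^i\sigma(y)$.
   Context: $A^+$ is the set of nonempty words over $A$; $|w|$ is the length of a word $w$. A substitution $\sigma:A\to A^+$ is extended to $A^+$ by concatenation, and to $A^{\mathbb Z}$ by concatenation so that in $\sigma(y)$ the word $\sigma(y[0])$ starts at coordinate $0$. $L(\sigma)$ is the set of all factors of the words $\sigma^n(a)$, $a\in A$, $n\ge1$. $X_\sigma=\{x\in A^{\mathbb Z}:x[-n,n]\in L(\sigma)\text{ for all }n\}$ and $T_\sigma$ is the left shift $(T_\sigma x)[n]=x[n+1]$. Standing assumption of the paper: $X_\sigma$ is uncountable. *)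

theory Defs
  imports Complex_Main "HOL-Library.Sublist" "HOL-Library.Countable_Set"
begin

text \<open>
  Words over the alphabet are lists, and the finite alphabet is a type of class \<open>finite\<close>.
  Bi-infinite sequences are functions from \<open>int\<close>.
\<close>

definition substitution :: "('a::finite \<Rightarrow> 'a list) \<Rightarrow> bool" where
  "substitution \<sigma> \<longleftrightarrow> (\<forall>a. \<sigma> a \<noteq> [])"

definition subst_word :: "('a \<Rightarrow> 'a list) \<Rightarrow> 'a list \<Rightarrow> 'a list" where
  "subst_word \<sigma> w = concat (map \<sigma> w)"

definition window :: "(int \<Rightarrow> 'a) \<Rightarrow> int \<Rightarrow> int \<Rightarrow> 'a list" where
  "window x i j = map x [i..j]"

text \<open>
  The image of a bi-infinite sequence, with \<open>\<sigma> (y 0)\<close> starting at coordinate 0. Since \<open>\<sigma>\<close> is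
  nonerasing, \<open>\<sigma>(y[0,n])\<close>, which occupies the coordinates from 0 on, has more than \<open>n\<close> letters; and
  for \<open>n < 0\<close> the word \<open>\<sigma>(y[n,-1])\<close>, which ends at coordinate -1, has at least \<open>-n\<close> letters, so
  coordinate \<open>n\<close> is its letter number \<open>-n-1\<close> counted from the right end. The lemmas below say
  that these values agree with all the words \<open>\<sigma>(y[0,n])\<close> and \<open>\<sigma>(y[-n,-1])\<close>.
\<close>

definition subst_seq :: "('a \<Rightarrow> 'a list) \<Rightarrow> (int \<Rightarrow> 'a) \<Rightarrow> int \<Rightarrow> 'a" where
  "subst_seq \<sigma> y n =
    (if 0 \<le> n then subst_word \<sigma> (window y 0 n) ! nat n
     else rev (subst_word \<sigma> (window y n (- 1))) ! nat (- n - 1))"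

definition shift :: "(int \<Rightarrow> 'a) \<Rightarrow> int \<Rightarrow> 'a" where
  "shift x = (\<lambda>n. x (n + 1))"

definition subst_language :: "('a \<Rightarrow> 'a list) \<Rightarrow> 'a list set" where
  "subst_language \<sigma> = {w. \<exists>a n. n \<ge> 1 \<and> sublist w ((subst_word \<sigma> ^^ n) [a])}"

definition subst_shift :: "('a \<Rightarrow> 'a list) \<Rightarrow> (int \<Rightarrow> 'a) set" where
  "subst_shift \<sigma> = {x. \<forall>n::nat. window x (- int n) (int n) \<in> subst_language \<sigma>}"

lemma subst_word_append: "subst_word \<sigma> (u @ v) = subst_word \<sigma> u @ subst_word \<sigma> v"
  by (simp add: subst_word_def)

lemma length_subst_word_ge:
  assumes "substitution \<sigma>"
  shows "length w \<le> length (subst_word \<sigma> w)"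
proof (induction w)
  case (Cons a w)
  have "length (\<sigma> a) > 0" using assms by (simp add: substitution_def)
  then have "Suc 0 \<le> length (\<sigma> a)" by (simp only: Suc_le_eq)
  with Cons show ?case unfolding subst_word_def by (simp del: length_greater_0_conv)
qed (simp add: subst_word_def)

lemma window_split:
  assumes "i \<le> j + 1" "j \<le> k"
  shows "window x i k = window x i j @ window x (j + 1) k"
proof (cases "i \<le> j")
  case True
  then show ?thesis using assms upto_split2[of i j k] by (simp add: window_def)
next
  case False
  then have "i = j + 1" using assms by simp
  then show ?thesis by (simp add: window_def)
qed

lemma subst_seq_right:
  assumes "substitution \<sigma>" and k: "k < length (subst_word \<sigma> (window y 0 (int n)))"
  shows "subst_seq \<sigma> y (int k) = subst_word \<sigma> (window y 0 (int n)) ! k"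
proof -
  have long: "k < length (subst_word \<sigma> (window y 0 (int k)))"
    using length_subst_word_ge[OF assms(1), of "window y 0 (int k)"] by (simp add: window_def)
  show ?thesis
  proof (cases "k \<le> n")
    case True
    then show ?thesis using long window_split[of 0 "int k" "int n" y]
      by (simp add: subst_seq_def subst_word_append nth_append)
  next
    case False
    then show ?thesis using k window_split[of 0 "int n" "int k" y]
      by (simp add: subst_seq_def subst_word_append nth_append)
  qed
qed

lemma subst_seq_left:
  assumes "substitution \<sigma>" and k: "k < length (subst_word \<sigma> (window y (- int n) (- 1)))"
  shows "subst_seq \<sigma> y (- int k - 1) = rev (subst_word \<sigma> (window y (- int n) (- 1))) ! k"
proof -
  define m where "m = - int k - 1"
  have m: "m < 0" "nat (- m - 1) = k" by (simp_all add: m_def)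
  have long: "k < length (subst_word \<sigma> (window y m (- 1)))"
    using length_subst_word_ge[OF assms(1), of "window y m (- 1)"]
    by (simp add: window_def m_def)
  have "subst_seq \<sigma> y m = rev (subst_word \<sigma> (window y (- int n) (- 1))) ! k"
  proof (cases "k < n")
    case True
    then have "- int n \<le> m" by (simp add: m_def)
    then show ?thesis using m long window_split[of "- int n" "m - 1" "- 1" y]
      by (simp add: subst_seq_def subst_word_append nth_append)
  next
    case False
    then have "m \<le> - int n" by (simp add: m_def)
    then show ?thesis using m k window_split[of m "- int n - 1" "- 1" y]
      by (simp add: subst_seq_def subst_word_append nth_append)
  qed
  then show ?thesis by (simp only: m_def)
qed

end

theory Submission
  imports Defs
begin

text \<open>
  Every long central window \<open>x[-N,N]\<close> of a point of the shift is a factor of some \<open>\<sigma>\<^sup>m(a)\<close>. The words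
  \<open>\<sigma>(a)\<close> have bounded length, so \<open>m \<ge> 2\<close>, and the window is a factor of \<open>\<sigma>(w)\<close> where \<open>w = \<sigma>\<^sup>m\<^sup>-\<^sup>1(a)\<close>
  is itself in the language. Centring \<open>w\<close> at the letter whose image covers the coordinate 0 of \<open>x\<close>
  gives a desubstitution of the window: a sequence \<open>y\<close> and an offset \<open>i\<close> (lemma
  \<open>ex_local_desubstitution\<close>). Since the images of letters have bounded length, the part of \<open>y\<close> that
  comes from \<open>w\<close> extends arbitrarily far on both sides as \<open>N\<close> grows. There are only finitely many
  offsets, so one of them serves arbitrarily long windows, and the finiteness of the alphabet gives a
  limit of the corresponding sequences \<open>y\<close> (lemma \<open>ex_limit_sequence\<close>). Every coordinate of
  \<open>\<sigma>(y)\<close> and every window of \<open>y\<close> depend on finitely many coordinates of \<open>y\<close>, so the limit is a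
  point of the shift and desubstitutes \<open>x\<close>.
\<close>

section \<open>Windows, factors and images\<close>

lemma window_nth:
  assumes "i + int k \<le> j"
  shows "window x i j ! k = x (i + int k)"
  using assms by (simp add: window_def nth_upto)

lemma length_window: "length (window x i j) = nat (j - i + 1)"
  by (simp add: window_def)

lemma window_cong:
  assumes "\<And>k. i \<le> k \<Longrightarrow> k \<le> j \<Longrightarrow> x k = y k"
  shows "window x i j = window y i j"
  using assms by (simp add: window_def)

lemma sublist_window:
  assumes "i \<le> i'" "i' \<le> j' + 1" "j' \<le> j"
  shows "sublist (window x i' j') (window x i j)"
proof -
  have "window x i j = window x i (i' - 1) @ window x i' j"
    using assms window_split[of i "i' - 1" j x] by simp
  also have "window x i' j = window x i' j' @ window x (j' + 1) j"
    using assms window_split[of i' j' j x] by simp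
  finally show ?thesis
    by (auto simp: sublist_def)
qed

lemma subst_language_sublist:
  assumes "w \<in> subst_language \<sigma>" "sublist v w"
  shows "v \<in> subst_language \<sigma>"
  using assms sublist_order.order_trans unfolding subst_language_def by blast

lemma shift_funpow: "(shift ^^ i) x k = x (k + int i)"
  by (induction i arbitrary: k) (simp_all add: shift_def algebra_simps)

lemma subst_seq_cong:
  assumes "\<And>k. \<bar>k\<bar> \<le> \<bar>t\<bar> \<Longrightarrow> y k = z k"
  shows "subst_seq \<sigma> y t = subst_seq \<sigma> z t"
proof -
  have "window y 0 t = window z 0 t" "t < 0 \<Longrightarrow> window y t (- 1) = window z t (- 1)"
    by (rule window_cong, rule assms, simp)+
  then show ?thesis by (simp add: subst_seq_def)
qed

lemma length_subst_word_le:
  assumes "\<And>a. length (\<sigma> a) \<le> M"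
  shows "length (subst_word \<sigma> w) \<le> M * length w"
proof (induction w)
  case (Cons a w)
  then show ?case using assms[of a] by (simp add: subst_word_def)
qed (simp add: subst_word_def)

lemma split_at_image_position:
  assumes "q < length (subst_word \<sigma> w)"
  obtains u c v where "w = u @ c # v" "length (subst_word \<sigma> u) \<le> q"
    "q < length (subst_word \<sigma> u) + length (\<sigma> c)"
proof -
  have "\<exists>u c v. w = u @ c # v \<and> length (subst_word \<sigma> u) \<le> q \<and>
      q < length (subst_word \<sigma> u) + length (\<sigma> c)"
    using assms
  proof (induction w arbitrary: q)
    case Nil
    then show ?case by (simp add: subst_word_def)
  next
    case (Cons a w)
    show ?case
    proof (cases "q < length (\<sigma> a)")
      case True
      then have "a # w = [] @ a # w \<and> length (subst_word \<sigma> []) \<le> q \<and>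
          q < length (subst_word \<sigma> []) + length (\<sigma> a)"
        by (simp add: subst_word_def)
      then show ?thesis by blast
    next
      case False
      then have "q - length (\<sigma> a) < length (subst_word \<sigma> w)"
        using Cons.prems by (simp add: subst_word_def)
      from Cons.IH[OF this] obtain u c v where
        *: "w = u @ c # v" "length (subst_word \<sigma> u) \<le> q - length (\<sigma> a)"
          "q - length (\<sigma> a) < length (subst_word \<sigma> u) + length (\<sigma> c)"
        by blast
      have "a # w = (a # u) @ c # v \<and> length (subst_word \<sigma> (a # u)) \<le> q \<and>
          q < length (subst_word \<sigma> (a # u)) + length (\<sigma> c)"
        using * False by (auto simp: subst_word_def)
      then show ?thesis by blast
    qed
  qed
  then show ?thesis using that by blast
qed

text \<open>
  The definition of \<open>subst_seq\<close> treats the two half-lines separately; here they are joined, so that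
  a factor of \<open>\<sigma>(u c v)\<close> that straddles the origin can be read off from one word.
\<close>

lemma subst_seq_eq_nth:
  assumes \<sigma>: "substitution \<sigma>"
    and y: "window y (- int (length u)) (int (length v)) = u @ c # v"
    and t: "- int (length (subst_word \<sigma> u)) \<le> t" "t < int (length (subst_word \<sigma> (c # v)))"
  shows "subst_seq \<sigma> y t = subst_word \<sigma> (u @ c # v) ! nat (t + int (length (subst_word \<sigma> u)))"
proof -
  have "window y (- int (length u)) (- 1) @ window y 0 (int (length v)) = u @ c # v"
    using y window_split[of "- int (length u)" "- 1" "int (length v)" y] by simp
  then have left: "window y (- int (length u)) (- 1) = u"
    and right: "window y 0 (int (length v)) = c # v"
    by (simp_all add: append_eq_append_conv length_window)
  show ?thesis
  proof (cases "0 \<le> t")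
    case True
    define k where "k = nat t"
    have k: "t = int k" "k < length (subst_word \<sigma> (c # v))"
      using True t by (auto simp: k_def)
    then have "subst_seq \<sigma> y t = subst_word \<sigma> (c # v) ! k"
      using subst_seq_right[OF \<sigma>, of k y "length v"] right by simp
    moreover have "nat (t + int (length (subst_word \<sigma> u))) = length (subst_word \<sigma> u) + k"
      using k by simp
    ultimately show ?thesis by (simp add: subst_word_append)
  next
    case False
    define k where "k = nat (- t - 1)"
    have k: "t = - int k - 1" "k < length (subst_word \<sigma> u)"
      using False t by (auto simp: k_def)
    then have "subst_seq \<sigma> y t = rev (subst_word \<sigma> u) ! k"
      using subst_seq_left[OF \<sigma>, of k y "length u"] left by simp
    also have "\<dots> = subst_word \<sigma> u ! (length (subst_word \<sigma> u) - Suc k)"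
      using k by (simp add: rev_nth)
    moreover have "nat (t + int (length (subst_word \<sigma> u))) = length (subst_word \<sigma> u) - Suc k"
      using k by simp
    moreover have "length (subst_word \<sigma> u) - Suc k < length (subst_word \<sigma> u)"
      using k(2) by linarith
    ultimately show ?thesis by (simp only: subst_word_append nth_append if_True)
  qed
qed

section \<open>Desubstitution of windows\<close>

text \<open>
  A window much longer than the images of letters is a factor of \<open>\<sigma>(w)\<close> with \<open>w\<close> in the language, and
  all letters of \<open>y\<close> near the origin are taken from \<open>w\<close>. The window of \<open>y\<close> is required to be in the
  language because this is the condition that passes to limits.
\<close>

lemma ex_local_desubstitution:
  fixes \<sigma> :: "'a::finite \<Rightarrow> 'a list"
  assumes \<sigma>: "substitution \<sigma>" and x: "x \<in> subst_shift \<sigma>"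
  shows "\<exists>y. \<exists>i<length (\<sigma> (y 0)). window y (- int n) (int n) \<in> subst_language \<sigma> \<and>
    (\<forall>k\<in>{- int n..int n}. x k = subst_seq \<sigma> y (k + int i))"
proof -
  define M where "M = Max (range (\<lambda>a. length (\<sigma> a)))"
  have M: "length (\<sigma> a) \<le> M" for a
    unfolding M_def by (rule Max_ge) auto
  have "length (\<sigma> undefined) > 0" using \<sigma> by (simp add: substitution_def)
  then have M_pos: "M > 0" using M[of undefined] by linarith
  \<comment> \<open>Losing the image of one letter on either side, the window still contains more than
    \<open>(n + 1) M\<close> letters on both sides of the image of the central letter, so it meets the images of
    at least \<open>n\<close> letters there.\<close>
  define N where "N = (n + 2) * M"
  have N: "N = (n + 1) * M + M" "n \<le> N"
    using M_pos by (auto simp: N_def algebra_simps intro: le_trans[of n "n * M"])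
  have "window x (- int N) (int N) \<in> subst_language \<sigma>"
    using x by (simp add: subst_shift_def)
  then obtain a m where am: "m \<ge> 1" "sublist (window x (- int N) (int N)) ((subst_word \<sigma> ^^ m) [a])"
    by (auto simp: subst_language_def)
  have "m \<noteq> 1"
  proof
    assume "m = 1"
    then have "2 * N + 1 \<le> M"
      using sublist_length_le[OF am(2)] M[of a] by (simp add: length_window subst_word_def nat_le_iff)
    then show False using N(1) by simp
  qed
  define w where "w = (subst_word \<sigma> ^^ (m - 1)) [a]"
  have w_lang: "w \<in> subst_language \<sigma>"
    using am(1) \<open>m \<noteq> 1\<close> unfolding subst_language_def w_def
    by (auto intro!: exI[of _ a] exI[of _ "m - 1"])
  have "(subst_word \<sigma> ^^ m) [a] = subst_word \<sigma> w"
    using am(1) by (cases m) (auto simp: w_def)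
  then obtain p s where ps: "subst_word \<sigma> w = p @ window x (- int N) (int N) @ s"
    using am(2) by (auto simp: sublist_def)
  define q where "q = length p + N"
  have len: "q + N + 1 \<le> length (subst_word \<sigma> w)"
    by (simp add: ps length_window q_def)
  have x_nth: "x k = subst_word \<sigma> w ! nat (k + int q)" if "\<bar>k\<bar> \<le> int N" for k
  proof -
    have "nat (k + int q) = length p + nat (k + int N)" "0 \<le> k + int N" "k \<le> int N"
      using that by (auto simp: q_def)
    then show ?thesis using that
      by (simp add: ps nth_append length_window window_nth nat_less_iff)
  qed
  obtain u c v where w: "w = u @ c # v"
    and q: "length (subst_word \<sigma> u) \<le> q" "q < length (subst_word \<sigma> u) + length (\<sigma> c)"
    using split_at_image_position[of q \<sigma> w] len by auto
  define i where "i = q - length (subst_word \<sigma> u)"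
  define y where "y k = w ! nat (k + int (length u))" for k
  have y: "window y (- int (length u)) (int (length v)) = u @ c # v"
    by (rule nth_equalityI) (simp_all add: length_window window_nth y_def w)
  have "(n + 1) * M < length (subst_word \<sigma> u)"
    using q(2) M[of c] N(1) by (simp add: q_def)
  also have "\<dots> \<le> M * length u" by (rule length_subst_word_le[OF M])
  finally have "(n + 1) * M < length u * M" by (simp only: mult.commute)
  then have u: "n \<le> length u" unfolding mult_less_cancel2 by linarith
  have "length (subst_word \<sigma> w) = length (subst_word \<sigma> u) + length (\<sigma> c) + length (subst_word \<sigma> v)"
    by (simp add: w subst_word_def)
  then have "(n + 1) * M < length (subst_word \<sigma> v)"
    using len q(1) M[of c] N(1) by linarith
  also have "\<dots> \<le> M * length v" by (rule length_subst_word_le[OF M])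
  finally have "(n + 1) * M < length v * M" by (simp only: mult.commute)
  then have v: "n \<le> length v" unfolding mult_less_cancel2 by linarith
  have "i < length (\<sigma> (y 0))"
    using q by (simp add: i_def y_def w)
  moreover have "sublist (window y (- int n) (int n)) w"
    using sublist_window[of "- int (length u)" "- int n" "int n" "int (length v)" y] u v y w by simp
  then have "window y (- int n) (int n) \<in> subst_language \<sigma>"
    by (rule subst_language_sublist[OF w_lang])
  moreover have "x k = subst_seq \<sigma> y (k + int i)" if "k \<in> {- int n..int n}" for k
  proof -
    have k: "\<bar>k\<bar> \<le> int N" using that N(2) by auto
    have "int q = int i + int (length (subst_word \<sigma> u))" using q(1) by (simp add: i_def)
    moreover have "length (subst_word \<sigma> w) =
        length (subst_word \<sigma> u) + length (subst_word \<sigma> (c # v))"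
      by (simp add: w subst_word_def)
    moreover have "int N \<le> int q" by (simp add: q_def)
    ultimately have "subst_seq \<sigma> y (k + int i) = subst_word \<sigma> w ! nat (k + int q)"
      using subst_seq_eq_nth[OF \<sigma> y, of "k + int i"] k len by (simp add: w add.assoc)
    then show ?thesis using x_nth[OF k] by simp
  qed
  ultimately show ?thesis by blast
qed

section \<open>Passage to the limit\<close>

text \<open>
  Compactness of the space of bi-infinite sequences over a finite alphabet, in the form of a
  cluster point. Each window takes finitely many values, so among infinitely many sequences
  that agree with the limit on \<open>[-n,n]\<close>, infinitely many agree with each other on \<open>[-n-1,n+1]\<close>.
\<close>

lemma ex_limit_sequence:
  fixes f :: "nat \<Rightarrow> int \<Rightarrow> 'a::finite"
  shows "\<exists>y. \<forall>n. \<exists>m\<ge>n. \<forall>k\<in>{- int n..int n}. f m k = y k"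
proof -
  have refine: "\<exists>z. infinite {m\<in>J. \<forall>k\<in>{- int n..int n}. f m k = z k} \<and> (\<exists>m\<in>J. z = f m)"
    if J: "infinite J" for J n
  proof -
    let ?W = "\<lambda>m. window (f m) (- int n) (int n)"
    have "?W ` J \<subseteq> {w. set w \<subseteq> UNIV \<and> length w = nat (2 * int n + 1)}"
      by (auto simp: length_window)
    then have "finite (?W ` J)"
      by (rule finite_subset) (rule finite_lists_length_eq, simp)
    from pigeonhole_infinite[OF J this] obtain m0 where
      m0: "m0 \<in> J" "infinite {m\<in>J. ?W m = ?W m0}"
      by auto
    have "{m\<in>J. ?W m = ?W m0} \<subseteq> {m\<in>J. \<forall>k\<in>{- int n..int n}. f m k = f m0 k}"
      by (auto simp: window_def)
    then show ?thesis using m0 finite_subset by blast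
  qed
  let ?J = "\<lambda>n z. {m. \<forall>k\<in>{- int n..int n}. f m k = z k}"
  have "\<exists>Y. \<forall>n. infinite (?J n (Y n)) \<and> (\<forall>k\<in>{- int n..int n}. Y (Suc n) k = Y n k)"
  proof (rule dependent_nat_choice)
    show "\<exists>z. infinite (?J 0 z)"
      using refine[OF infinite_UNIV_nat, of 0] by auto
  next
    fix z n assume "infinite (?J n z)"
    from refine[OF this, of "Suc n"] obtain z' where
      z': "infinite {m\<in>?J n z. \<forall>k\<in>{- int (Suc n)..int (Suc n)}. f m k = z' k}"
        "\<exists>m\<in>?J n z. z' = f m"
      by blast
    have "infinite (?J (Suc n) z')"
      by (rule infinite_super[OF _ z'(1)]) auto
    then show "\<exists>z'. infinite (?J (Suc n) z') \<and> (\<forall>k\<in>{- int n..int n}. z' k = z k)"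
      using z'(2) by blast
  qed
  then obtain Y where inf: "\<And>n. infinite (?J n (Y n))"
    and step: "\<And>n k. k \<in> {- int n..int n} \<Longrightarrow> Y (Suc n) k = Y n k"
    by blast
  have stable: "Y (n + d) k = Y n k" if "k \<in> {- int n..int n}" for n d k
    using that by (induction d) (auto simp: step)
  define y where "y k = Y (nat \<bar>k\<bar>) k" for k
  have y: "y k = Y n k" if "k \<in> {- int n..int n}" for n k
  proof -
    have "k \<in> {- int (nat \<bar>k\<bar>)..int (nat \<bar>k\<bar>)}" "nat \<bar>k\<bar> + (n - nat \<bar>k\<bar>) = n"
      using that by auto
    then show ?thesis
      using stable[of k "nat \<bar>k\<bar>" "n - nat \<bar>k\<bar>"] by (simp only: y_def)
  qed
  have "\<exists>m\<ge>n. \<forall>k\<in>{- int n..int n}. f m k = y k" for n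
  proof -
    obtain m where "m \<ge> n" "m \<in> ?J n (Y n)"
      using inf[of n] by (meson infinite_nat_iff_unbounded_le)
    then show ?thesis using y[of _ n] by auto
  qed
  then show ?thesis by blast
qed

theorem proposition5p10:
  fixes \<sigma> :: "'a::finite \<Rightarrow> 'a list"
  assumes "substitution \<sigma>"
    and "uncountable (subst_shift \<sigma>)"
  shows "\<forall>x\<in>subst_shift \<sigma>. \<exists>y\<in>subst_shift \<sigma>. \<exists>i<length (\<sigma> (y 0)).
    x = (shift ^^ i) (subst_seq \<sigma> y)"
proof
  fix x assume x: "x \<in> subst_shift \<sigma>"
  define G where "G n i y \<longleftrightarrow> i < length (\<sigma> (y 0)) \<and>
    window y (- int n) (int n) \<in> subst_language \<sigma> \<and>
    (\<forall>k\<in>{- int n..int n}. x k = subst_seq \<sigma> y (k + int i))" for n i and y :: "int \<Rightarrow> 'a"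
  have G_mono: "G n i y" if "G m i y" "n \<le> m" for n m i y
    using that subst_language_sublist[OF _ sublist_window[of "- int m" "- int n" "int n" "int m" y]]
    by (auto simp: G_def)
  have "\<exists>y i. G n i y" for n
    using ex_local_desubstitution[OF assms(1) x, of n] unfolding G_def by blast
  then obtain z j where zj: "\<And>n. G n (j n) (z n)"
    by metis
  have "j n \<in> (\<Union>a. {..<length (\<sigma> a)})" for n
    using zj[of n] by (auto simp: G_def)
  then have "finite (range j)"
    by (intro finite_subset[of "range j" "\<Union>a. {..<length (\<sigma> a)}"]) auto
  from pigeonhole_infinite[OF infinite_UNIV_nat this]
  obtain n0 where inf: "infinite {n. j n = j n0}"
    by auto
  define i where "i = j n0"
  have "\<exists>y. G n i y" for n
  proof -
    obtain m where "m \<ge> n" "j m = i"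
      using inf unfolding infinite_nat_iff_unbounded_le i_def by blast
    then show ?thesis using zj[of m] G_mono by blast
  qed
  then obtain f where f: "\<And>n. G n i (f n)"
    by metis
  obtain y where lim: "\<And>n. \<exists>m\<ge>n. \<forall>k\<in>{- int n..int n}. f m k = y k"
    using ex_limit_sequence[of f] by blast
  have "G n i y" for n
  proof -
    \<comment> \<open>The coordinates of \<open>\<sigma>(y)\<close> that are compared with \<open>x[-n,n]\<close> have absolute value at most
      \<open>n + i\<close>, and they depend on no coordinate of \<open>y\<close> further from 0.\<close>
    obtain m where m: "m \<ge> n + i" and eq: "\<And>k. k \<in> {- int (n + i)..int (n + i)} \<Longrightarrow> f m k = y k"
      using lim[of "n + i"] by blast
    have "G n i (f m)"
      using G_mono[OF f[of m], of n] m by simp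
    moreover have "f m 0 = y 0"
      by (rule eq) simp
    moreover have "window (f m) (- int n) (int n) = window y (- int n) (int n)"
      by (rule window_cong, rule eq) auto
    moreover have "subst_seq \<sigma> (f m) (k + int i) = subst_seq \<sigma> y (k + int i)"
      if "k \<in> {- int n..int n}" for k
      by (rule subst_seq_cong, rule eq) (use that in auto)
    ultimately show ?thesis by (simp add: G_def)
  qed
  note G = this
  have "y \<in> subst_shift \<sigma>"
    using G by (simp add: subst_shift_def G_def)
  moreover have "i < length (\<sigma> (y 0))"
    using G[of 0] by (simp add: G_def)
  moreover have "x = (shift ^^ i) (subst_seq \<sigma> y)"
  proof
    fix k
    have "k \<in> {- int (nat \<bar>k\<bar>)..int (nat \<bar>k\<bar>)}"
      by auto
    then show "x k = (shift ^^ i) (subst_seq \<sigma> y) k"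
      using G[of "nat \<bar>k\<bar>"] unfolding G_def shift_funpow by blast
  qed
  ultimately show "\<exists>y\<in>subst_shift \<sigma>. \<exists>i<length (\<sigma> (y 0)). x = (shift ^^ i) (subst_seq \<sigma> y)"
    by blast
qed

end
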